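(* Let $(X,d)$ be a compact metric space, let $f_0,\dots,f_{m-1}$ be homeomorphisms of $X$ to itself, and let $\varphi\in C(X,\mathbb{R})$. Then $$P(f_0,\dots,f_{m-1},\varphi)=P(f_0^{-1},\dots,f_{m-1}^{-1},\varphi),$$ where $P(\cdot)$ denotes the topological pressure of the free semigroup action generated by the listed maps.
   Context: Here $m\ge 1$ is an integer and $F_m^+$ is the set of finite words in the symbols $0,1,\dots,m-1$; $|w|$ is the length of $w$. For continuous maps $h_0,\dots,h_{m-1}:X\to X$ and $w=w_k\cdots w_1$ put $h_w=h_{w_k}\circ\cdots\circ h_{w_1}$, with $h_\emptyset=\mathrm{id}$ for the empty word. The relation $w'\le w$ means that $w=w''w'$ for some word $w''$; when $w'\le w$ is used as an index for $w=w_k\cdots w_1$, $w'$ ranges over the $k=|w|$ words $\emptyset,\ w_1,\ w_2w_1,\ \dots,\ w_{k-1}\cdots w_1$. Put $(S_w\varphi)(x)=\sum_{w'\le w}\varphi(h_{w'}x)$ and $d_w(x,y)=\max_{w'\le w}d(h_{w'}x,h_{w'}y)$. For $\varepsilon>0$, $F\subset X$ is a $(w,\varepsilon,h_0,\dots,h_{m-1})$-spanning set of $X$ if for every $x\in X$ there is $y\in F$ with $d_w(x,y)\le\varepsilon$. Let $Q_w(h_0,\dots,h_{m-1},\varphi,\varepsilon)=\inf\{\sum_{x\in F}e^{(S_w\varphi)(x)}: F \text{ is a } (w,\varepsilon,h_0,\dots,h_{m-1})\text{-spanning set of }X\}$, $Q_n(h_0,\dots,h_{m-1},\varphi,\varepsilon)=\frac1{m^n}\sum_{|w|=n}Q_w(h_0,\dots,h_{m-1},\varphi,\varepsilon)$,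 and $$P(h_0,\dots,h_{m-1},\varphi)=\lim_{\varepsilon\to0}\limsup_{n\to\infty}\tfrac1n\log Q_n(h_0,\dots,h_{m-1},\varphi,\varepsilon)$$ (a value in the extended reals). *)

theory Defs
  imports "HOL-Analysis.Analysis" "HOL-Library.Sublist"
begin

text \<open>
  The word \<open>w\<^sub>k \<cdots> w\<^sub>1\<close> is the list \<open>[w\<^sub>k, \<dots>, w\<^sub>1]\<close>, in the order in which it is written. So the
  last entry of the list acts first, and \<open>w = w'' w'\<close> says that \<open>w'\<close> is a suffix of the list \<open>w\<close>.
  The \<open>k\<close> words over which \<open>w' \<le> w\<close> ranges as an index (all but \<open>w\<close> itself) are the strict
  suffixes of \<open>w\<close>.
\<close>

definition words :: "nat \<Rightarrow> nat \<Rightarrow> nat list set" where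
  "words m n = {w. set w \<subseteq> {..<m} \<and> length w = n}"

fun word_map :: "(nat \<Rightarrow> 'a \<Rightarrow> 'a) \<Rightarrow> nat list \<Rightarrow> 'a \<Rightarrow> 'a" where
  "word_map h [] = id"
| "word_map h (i # w) = h i \<circ> word_map h w"

definition birkhoff_sum :: "(nat \<Rightarrow> 'a \<Rightarrow> 'a) \<Rightarrow> nat list \<Rightarrow> ('a \<Rightarrow> real) \<Rightarrow> 'a \<Rightarrow> real" where
  "birkhoff_sum h w \<phi> x = (\<Sum>w' | strict_suffix w' w. \<phi> (word_map h w' x))"

text \<open>
  For the empty word the maximum below is over the empty set and hence unspecified. Only words of
  length \<open>n \<rightarrow> \<infinity>\<close> matter for the pressure.
\<close>

definition word_dist ::
    "(nat \<Rightarrow> 'a::metric_space \<Rightarrow> 'a) \<Rightarrow> nat list \<Rightarrow> 'a \<Rightarrow> 'a \<Rightarrow> real" where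
  "word_dist h w x y = Max {dist (word_map h w' x) (word_map h w' y) | w'. strict_suffix w' w}"

definition spanning ::
    "'a::metric_space set \<Rightarrow> (nat \<Rightarrow> 'a \<Rightarrow> 'a) \<Rightarrow> nat list \<Rightarrow> real \<Rightarrow> 'a set \<Rightarrow> bool" where
  "spanning X h w \<epsilon> F \<longleftrightarrow> F \<subseteq> X \<and> (\<forall>x\<in>X. \<exists>y\<in>F. word_dist h w x y \<le> \<epsilon>)"

text \<open>
  Spanning sets need not be finite, so the sum is taken in \<open>[0, \<infinity>]\<close>.
\<close>

definition Q_word ::
    "'a::metric_space set \<Rightarrow> (nat \<Rightarrow> 'a \<Rightarrow> 'a) \<Rightarrow> ('a \<Rightarrow> real) \<Rightarrow> real \<Rightarrow> nat list \<Rightarrow> ennreal" where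
  "Q_word X h \<phi> \<epsilon> w =
     (INF F\<in>{F. spanning X h w \<epsilon> F}. \<Sum>\<^sub>\<infinity>x\<in>F. ennreal (exp (birkhoff_sum h w \<phi> x)))"

definition Q_avg ::
    "'a::metric_space set \<Rightarrow> nat \<Rightarrow> (nat \<Rightarrow> 'a \<Rightarrow> 'a) \<Rightarrow> ('a \<Rightarrow> real) \<Rightarrow> real \<Rightarrow> nat \<Rightarrow> ennreal" where
  "Q_avg X m h \<phi> \<epsilon> n = (\<Sum>w\<in>words m n. Q_word X h \<phi> \<epsilon> w) / of_nat (m ^ n)"

definition ext_ln :: "ennreal \<Rightarrow> ereal" where
  "ext_ln q = (if q = 0 then -\<infinity> else if q = \<infinity> then \<infinity> else ereal (ln (enn2real q)))"

definition pressure ::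
    "'a::metric_space set \<Rightarrow> nat \<Rightarrow> (nat \<Rightarrow> 'a \<Rightarrow> 'a) \<Rightarrow> ('a \<Rightarrow> real) \<Rightarrow> ereal" where
  "pressure X m h \<phi> =
     Lim (at_right 0) (\<lambda>\<epsilon>::real. limsup (\<lambda>n. ereal (1 / real n) * ext_ln (Q_avg X m h \<phi> \<epsilon> n)))"

text \<open>The limit in the definition of \<^const>\<open>pressure\<close> always exists, by monotonicity.\<close>

lemma ext_ln_mono:
  assumes "p \<le> q"
  shows "ext_ln p \<le> ext_ln q"
proof (cases "p = 0 \<or> q = \<infinity>")
  case True
  then show ?thesis by (auto simp: ext_ln_def)
next
  case False
  then have "p \<noteq> 0" "q \<noteq> \<infinity>" "q \<noteq> 0" "p \<noteq> \<infinity>"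
    using assms by (auto simp: top_unique)
  moreover from this have "0 < enn2real p" "enn2real p \<le> enn2real q"
    using assms by (auto simp: enn2real_positive_iff less_top zero_less_iff_neq_zero intro!: enn2real_mono)
  ultimately show ?thesis by (simp add: ext_ln_def)
qed

lemma Q_avg_antimono:
  assumes "\<epsilon> \<le> \<epsilon>'"
  shows "Q_avg X m h \<phi> \<epsilon>' n \<le> Q_avg X m h \<phi> \<epsilon> n"
proof -
  have "Q_word X h \<phi> \<epsilon>' w \<le> Q_word X h \<phi> \<epsilon> w" for w
    unfolding Q_word_def
    using assms by (intro INF_superset_mono) (auto simp: spanning_def, meson order_trans)
  then show ?thesis
    unfolding Q_avg_def by (intro divide_right_mono_ennreal sum_mono)
qed

lemma pressure_tendsto:
  "((\<lambda>\<epsilon>::real. limsup (\<lambda>n. ereal (1 / real n) * ext_ln (Q_avg X m h \<phi> \<epsilon> n)))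
     \<longlongrightarrow> pressure X m h \<phi>) (at_right 0)"
proof -
  define L where "L = (\<lambda>\<epsilon>::real. limsup (\<lambda>n. ereal (1 / real n) * ext_ln (Q_avg X m h \<phi> \<epsilon> n)))"
  have anti: "L \<epsilon>' \<le> L \<epsilon>" if "\<epsilon> \<le> \<epsilon>'" for \<epsilon> \<epsilon>'
    unfolding L_def
    by (intro Limsup_mono always_eventually allI ereal_mult_left_mono ext_ln_mono
          Q_avg_antimono that) auto
  have "(L \<longlongrightarrow> (SUP \<epsilon>\<in>{0<..}. L \<epsilon>)) (at_right 0)"
  proof (rule increasing_tendsto)
    show "\<forall>\<^sub>F \<epsilon> in at_right 0. L \<epsilon> \<le> (SUP \<epsilon>\<in>{0<..}. L \<epsilon>)"
      by (auto simp: eventually_at_filter intro!: always_eventually SUP_upper)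
  next
    fix a assume "a < (SUP \<epsilon>\<in>{0<..}. L \<epsilon>)"
    then obtain e where e: "e > 0" "a < L e"
      by (auto simp: less_SUP_iff)
    have "\<forall>\<^sub>F \<epsilon> in at_right 0. \<epsilon> < e"
      using e(1) by (auto simp: eventually_at_right_field)
    then show "\<forall>\<^sub>F \<epsilon> in at_right 0. a < L \<epsilon>"
      by eventually_elim (use e anti in \<open>auto intro: less_le_trans\<close>)
  qed
  then show ?thesis
    using tendsto_Lim[of "at_right (0::real)" L] by (simp add: L_def pressure_def)
qed

end

theory Submission
  imports Defs
begin

text \<open>
  Running an orbit segment backwards turns it into an orbit segment of the inverse maps through the
  same points. For a word \<open>w = a u\<close> the index words of \<open>S\<^sub>w\<close> and \<open>d\<^sub>w\<close> are the suffixes of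
  \<open>u\<close>, so the first letter \<open>a\<close> is never applied and the segment from \<open>x\<close> runs to \<open>h\<^sub>u x\<close>. If
  \<open>\<bar>u\<close> is the reversal of \<open>u\<close>, then the segment of \<open>h\<^sub>u x\<close> for the word \<open>a \<bar>u\<close> and the
  inverse maps visits the same points in the opposite order. Hence the bijection \<open>h\<^sub>u\<close> of \<open>X\<close>
  carries the Birkhoff sums and the metric of \<open>a u\<close> to those of \<open>a \<bar>u\<close>, and takes spanning sets to
  spanning sets without changing their weight. This shows one inequality between the two values of
  \<open>Q\<close> (\<open>Q_word_reversed_tail_le\<close>), and exchanging the roles of the two families gives the
  other.

  Keeping \<open>a\<close> in place makes \<open>a u \<mapsto> a \<bar>u\<close> an involution on the words of each length
  \<open>n \<ge> 1\<close>. So the averages \<open>Q\<^sub>n\<close> of the two families agree for every \<open>\<epsilon>\<close>, and the limits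
  defining the pressure agree term by term.
\<close>

lemma strict_suffixes_Cons: "{s. strict_suffix s (a # u)} = (\<lambda>k. drop k u) ` {..length u}"
proof -
  have "\<exists>k\<le>length u. s = drop k u" if "suffix s u" for s
    using that by (intro exI[of _ "length u - length s"]) (auto simp: suffix_def)
  moreover have "strict_suffix s (a # u) \<longleftrightarrow> suffix s u" for s
    by (auto simp: strict_suffix_def suffix_Cons dest: suffix_length_le)
  ultimately show ?thesis
    by (auto simp: suffix_drop image_iff Bex_def)
qed

lemma birkhoff_sum_Cons:
  "birkhoff_sum h (a # u) \<phi> x = (\<Sum>k\<le>length u. \<phi> (word_map h (drop k u) x))"
proof -
  have "inj_on (\<lambda>k. drop k u) {..length u}"
    by (rule inj_onI) (metis atMost_iff diff_diff_cancel length_drop)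
  then show ?thesis
    unfolding birkhoff_sum_def strict_suffixes_Cons by (simp add: sum.reindex)
qed

lemma word_dist_Cons:
  "word_dist h (a # u) x y =
     Max ((\<lambda>k. dist (word_map h (drop k u) x) (word_map h (drop k u) y)) ` {..length u})"
proof -
  have "{dist (word_map h s x) (word_map h s y) | s. strict_suffix s (a # u)} =
      (\<lambda>s. dist (word_map h s x) (word_map h s y)) ` {s. strict_suffix s (a # u)}"
    by blast
  then show ?thesis
    unfolding word_dist_def strict_suffixes_Cons by (simp add: image_image)
qed

lemma word_map_append: "word_map h (v @ w) x = word_map h v (word_map h w x)"
  by (induction v) auto

lemma image_diff_atMost: "(\<lambda>k. n - k) ` {..n} = {..n::nat}"
proof -
  have "k \<in> (\<lambda>k. n - k) ` {..n}" if "k \<le> n" for k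
    using that by (intro image_eqI[of _ _ "n - k"]) auto
  then show ?thesis by auto
qed

locale inverse_families =
  fixes X :: "'a::metric_space set" and m :: nat and h g :: "nat \<Rightarrow> 'a \<Rightarrow> 'a"
  assumes h_mem: "i < m \<Longrightarrow> x \<in> X \<Longrightarrow> h i x \<in> X"
    and g_mem: "i < m \<Longrightarrow> x \<in> X \<Longrightarrow> g i x \<in> X"
    and g_h: "i < m \<Longrightarrow> x \<in> X \<Longrightarrow> g i (h i x) = x"
    and h_g: "i < m \<Longrightarrow> x \<in> X \<Longrightarrow> h i (g i x) = x"
begin

lemma inverse_families_swap: "inverse_families X m g h"
  by unfold_locales (auto simp: h_mem g_mem g_h h_g)

lemma word_map_mem: "set w \<subseteq> {..<m} \<Longrightarrow> x \<in> X \<Longrightarrow> word_map h w x \<in> X"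
  by (induction w) (auto simp: h_mem)

lemma word_map_rev_inverse:
  "set w \<subseteq> {..<m} \<Longrightarrow> x \<in> X \<Longrightarrow> word_map g (rev w) (word_map h w x) = x"
  by (induction w) (auto simp: word_map_append g_h word_map_mem)

text \<open>
  After \<open>k\<close> letters are dropped from the reversal of \<open>u\<close>, the remaining inverse maps undo exactly
  the last \<open>|u| - k\<close> maps that were applied in \<open>h\<^sub>u\<close>.
\<close>

lemma reversed_orbit:
  assumes "set u \<subseteq> {..<m}" "x \<in> X"
  shows "word_map g (drop k (rev u)) (word_map h u x) = word_map h (drop (length u - k) u) x"
proof -
  let ?p = "take (length u - k) u" and ?s = "drop (length u - k) u"
  have sub: "set ?p \<subseteq> {..<m}" "set ?s \<subseteq> {..<m}"
    using assms(1) set_take_subset set_drop_subset by fast+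
  have "word_map h u x = word_map h ?p (word_map h ?s x)"
    by (metis append_take_drop_id word_map_append)
  then show ?thesis
    using word_map_rev_inverse[OF sub(1) word_map_mem[OF sub(2) assms(2)]]
    by (simp add: drop_rev)
qed

lemma birkhoff_sum_reversed_tail:
  assumes "set u \<subseteq> {..<m}" "x \<in> X"
  shows "birkhoff_sum g (a # rev u) \<phi> (word_map h u x) = birkhoff_sum h (a # u) \<phi> x"
proof -
  have "birkhoff_sum g (a # rev u) \<phi> (word_map h u x) =
      (\<Sum>k\<le>length u. \<phi> (word_map h (drop (length u - k) u) x))"
    by (simp add: birkhoff_sum_Cons reversed_orbit[OF assms])
  also have "\<dots> = (\<Sum>k\<le>length u. \<phi> (word_map h (drop k u) x))"
    by (rule sum.reindex_bij_witness[of _ "\<lambda>k. length u - k" "\<lambda>k. length u - k"]) auto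
  finally show ?thesis by (simp add: birkhoff_sum_Cons)
qed

lemma word_dist_reversed_tail:
  assumes "set u \<subseteq> {..<m}" "x \<in> X" "y \<in> X"
  shows "word_dist g (a # rev u) (word_map h u x) (word_map h u y) = word_dist h (a # u) x y"
proof -
  let ?D = "\<lambda>k. dist (word_map h (drop k u) x) (word_map h (drop k u) y)"
  have "word_dist g (a # rev u) (word_map h u x) (word_map h u y) =
      Max (?D ` (\<lambda>k. length u - k) ` {..length u})"
    by (simp add: word_dist_Cons reversed_orbit assms image_image)
  then show ?thesis
    by (simp add: word_dist_Cons image_diff_atMost)
qed

lemma spanning_reversed_tail:
  assumes u: "set u \<subseteq> {..<m}" and F: "spanning X h (a # u) \<epsilon> F"
  shows "spanning X g (a # rev u) \<epsilon> (word_map h u ` F)"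
  unfolding spanning_def
proof (intro conjI ballI)
  have FX: "F \<subseteq> X" using F by (simp add: spanning_def)
  then show "word_map h u ` F \<subseteq> X" using word_map_mem[OF u] by auto
  interpret swap: inverse_families X m g h by (rule inverse_families_swap)
  fix z assume z: "z \<in> X"
  define x where "x = word_map g (rev u) z"
  have x: "x \<in> X" "word_map h u x = z"
    using swap.word_map_mem[of "rev u" z] swap.word_map_rev_inverse[of "rev u" z] u z
    by (simp_all add: x_def)
  obtain y where y: "y \<in> F" "word_dist h (a # u) x y \<le> \<epsilon>"
    using F x(1) by (auto simp: spanning_def)
  then have "word_dist g (a # rev u) z (word_map h u y) \<le> \<epsilon>"
    using word_dist_reversed_tail[OF u x(1), of y a] FX x(2) by auto
  then show "\<exists>y\<in>word_map h u ` F. word_dist g (a # rev u) z y \<le> \<epsilon>"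
    using y(1) by blast
qed

lemma Q_word_reversed_tail_le:
  assumes u: "set u \<subseteq> {..<m}"
  shows "Q_word X g \<phi> \<epsilon> (a # rev u) \<le> Q_word X h \<phi> \<epsilon> (a # u)"
  unfolding Q_word_def
proof (rule INF_mono)
  fix F assume "F \<in> {F. spanning X h (a # u) \<epsilon> F}"
  then have F: "spanning X h (a # u) \<epsilon> F" by simp
  then have FX: "F \<subseteq> X" by (simp add: spanning_def)
  have "inj_on (word_map h u) F"
    using word_map_rev_inverse[OF u] FX
    by (intro inj_on_inverseI[where g = "word_map g (rev u)"]) blast
  then have "(\<Sum>\<^sub>\<infinity>x\<in>word_map h u ` F. ennreal (exp (birkhoff_sum g (a # rev u) \<phi> x))) =
      (\<Sum>\<^sub>\<infinity>x\<in>F. ennreal (exp (birkhoff_sum g (a # rev u) \<phi> (word_map h u x))))"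
    by (simp add: infsum_reindex comp_def)
  also have "\<dots> = (\<Sum>\<^sub>\<infinity>x\<in>F. ennreal (exp (birkhoff_sum h (a # u) \<phi> x)))"
    using FX by (intro infsum_cong) (auto simp: birkhoff_sum_reversed_tail[OF u])
  finally show "\<exists>G\<in>{G. spanning X g (a # rev u) \<epsilon> G}.
      (\<Sum>\<^sub>\<infinity>x\<in>G. ennreal (exp (birkhoff_sum g (a # rev u) \<phi> x)))
        \<le> (\<Sum>\<^sub>\<infinity>x\<in>F. ennreal (exp (birkhoff_sum h (a # u) \<phi> x)))"
    using spanning_reversed_tail[OF u F] by (intro bexI[of _ "word_map h u ` F"]) simp_all
qed

lemma Q_word_reversed_tail:
  assumes "set u \<subseteq> {..<m}"
  shows "Q_word X g \<phi> \<epsilon> (a # rev u) = Q_word X h \<phi> \<epsilon> (a # u)"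
proof (rule antisym)
  interpret swap: inverse_families X m g h by (rule inverse_families_swap)
  show "Q_word X h \<phi> \<epsilon> (a # u) \<le> Q_word X g \<phi> \<epsilon> (a # rev u)"
    using swap.Q_word_reversed_tail_le[of "rev u"] assms by simp
qed (rule Q_word_reversed_tail_le[OF assms])

lemma Q_avg_inverse_eq:
  assumes "n > 0"
  shows "Q_avg X m g \<phi> \<epsilon> n = Q_avg X m h \<phi> \<epsilon> n"
proof -
  let ?r = "\<lambda>w. hd w # rev (tl w)"
  have word: "\<exists>a u. w = a # u \<and> a < m \<and> set u \<subseteq> {..<m} \<and> length u = n - 1"
    if "w \<in> words m n" for w
    using that assms by (cases w) (auto simp: words_def)
  have "(\<Sum>w\<in>words m n. Q_word X h \<phi> \<epsilon> w) = (\<Sum>w\<in>words m n. Q_word X g \<phi> \<epsilon> w)"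
  proof (rule sum.reindex_bij_witness[of _ ?r ?r])
    fix w assume "w \<in> words m n"
    then obtain a u where "w = a # u" "a < m" "set u \<subseteq> {..<m}" "length u = n - 1"
      using word by blast
    then show "?r (?r w) = w" "?r w \<in> words m n" "Q_word X g \<phi> \<epsilon> (?r w) = Q_word X h \<phi> \<epsilon> w"
      "?r (?r w) = w" "?r w \<in> words m n"
      using assms by (auto simp: words_def Q_word_reversed_tail)
  qed
  then show ?thesis by (simp add: Q_avg_def)
qed

lemma pressure_inverse_eq: "pressure X m g \<phi> = pressure X m h \<phi>"
proof -
  \<comment> \<open>At \<open>n = 0\<close> the factor \<open>1 / real n\<close> is \<open>0\<close>, so both terms vanish.\<close>
  have "ereal (1 / real n) * ext_ln (Q_avg X m g \<phi> \<epsilon> n) =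
      ereal (1 / real n) * ext_ln (Q_avg X m h \<phi> \<epsilon> n)" for \<epsilon> n
    by (cases "n = 0") (simp_all add: Q_avg_inverse_eq zero_ereal_def[symmetric])
  then show ?thesis by (simp only: pressure_def)
qed

end

theorem theorem1p5:
  fixes X :: "'a::metric_space set"
    and m :: nat
    and f :: "nat \<Rightarrow> 'a \<Rightarrow> 'a"
    and \<phi> :: "'a \<Rightarrow> real"
  assumes "m \<ge> 1"
    and "compact X"
    and "\<And>i. i < m \<Longrightarrow> \<exists>g. homeomorphism X X (f i) g"
    and "continuous_on X \<phi>"
  shows "pressure X m f \<phi> = pressure X m (\<lambda>i. inv_into X (f i)) \<phi>"
proof -
  have bij: "bij_betw (f i) X X" if "i < m" for i
    using assms(3)[OF that] by (auto simp: homeomorphism_def bij_betw_def intro: inj_on_inverseI)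
  interpret inverse_families X m f "\<lambda>i. inv_into X (f i)"
  proof
    fix i x assume i: "i < m" and x: "x \<in> X"
    show "f i x \<in> X" by (rule bij_betw_apply[OF bij[OF i] x])
    show "inv_into X (f i) x \<in> X" by (rule bij_betw_apply[OF bij_betw_inv_into[OF bij[OF i]] x])
    show "inv_into X (f i) (f i x) = x" by (rule bij_betw_inv_into_left[OF bij[OF i] x])
    show "f i (inv_into X (f i) x) = x" by (rule bij_betw_inv_into_right[OF bij[OF i] x])
  qed
  show ?thesis by (rule pressure_inverse_eq[symmetric])
qed

end
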